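(* Let $k$ be an uncountable algebraically closed field, let $d\geq 2$, let $H\subset\mathbb{P}^d$ be a hyperplane, let $\Gamma\subseteq H$ be a finite set of (closed) points spanning $H$, let $p\in\mathbb{P}^d$ be a point not contained in $H$, and let $C_\Gamma\subset\mathbb{P}^d$ be the cone over $\Gamma$ with vertex $p$. Then $C_\Gamma$ can be embedded in a linear projection of the weighted projective plane $\mathbb{P}(1,1,n)$ if $n$ is sufficiently large; that is, there is $n_0$ (depending on $\Gamma$) such that for every $n\geq n_0$ there is a linear projection of $\mathbb{P}(1,1,n)$ into which $C_\Gamma$ admits a closed immersion.
   Context: All schemes are over $k$. The curve $C_\Gamma$ is the reduced union of the $|\Gamma|$ lines joining $p$ to the points of $\Gamma$. For $n\geq 1$, $\mathbb{P}(1,1,n)=\operatorname{Proj}k[s,t,u]$ with $\deg s=\deg t=1$, $\deg u=n$; it is embedded in $\mathbb{P}^{n+1}$ by $[s:t:u]\mapsto[u:s^n:s^{n-1}t:\cdots:t^n]$, with image the cone over the rational normal curve of degree $n$. A linear projection of $\mathbb{P}(1,1,n)$ is the image (with reduced structure) of this surface in a projective space $\mathbb{P}^r$ under a linear projection $\mathbb{P}^{n+1}\dashrightarrow\mathbb{P}^r$ whose center is disjoint from the surface. *)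

theory Defs
  imports
    "HOL-Analysis.Abstract_Topology"
    "HOL-Library.Countable_Set"
    "HOL-Library.Poly_Mapping"
    "HOL-Computational_Algebra.Polynomial"
    "Jordan_Normal_Form.Matrix_Kernel"
begin

text \<open>
  Over an algebraically closed field \<open>k\<close>, a reduced closed subscheme of projective \<open>n\<close>-space is
  determined by its set of closed points, and its structure sheaf restricted to closed points is
  the sheaf of regular \<open>k\<close>-valued functions; morphisms over \<open>k\<close> between such schemes are the
  continuous maps that pull regular functions back to regular functions. All schemes
  below are represented in this way.
\<close>

subsection \<open>Projective space and linear subspaces\<close>

text \<open>A point is the set of all its homogeneous coordinate vectors.\<close>

type_synonym 'k point = "'k vec set"

definition proj_point :: "'k::field vec \<Rightarrow> 'k point" where
  "proj_point v = {c \<cdot>\<^sub>v v | c. c \<noteq> 0}"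

definition proj_of :: "nat \<Rightarrow> 'k::field vec set \<Rightarrow> 'k point set" where
  "proj_of n W = proj_point ` (W - {0\<^sub>v (n + 1)})"

definition proj_space :: "nat \<Rightarrow> 'k::field point set" where
  "proj_space n = proj_of n (carrier_vec (n + 1))"

definition proj_span :: "nat \<Rightarrow> 'k::field point set \<Rightarrow> 'k point set" where
  "proj_span n S =
     proj_of n (LinearCombinations.module.span class_ring (module_vec TYPE('k) (n + 1)) (\<Union>S))"

definition hyperplane :: "nat \<Rightarrow> 'k::field point set \<Rightarrow> bool" where
  "hyperplane n H \<longleftrightarrow>
     (\<exists>a \<in> carrier_vec (n + 1). a \<noteq> 0\<^sub>v (n + 1) \<and>
        H = proj_of n {v \<in> carrier_vec (n + 1). a \<bullet> v = 0})"

text \<open>The cone over a set of points: the union of the lines joining the vertex to these points.\<close>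

definition cone_over :: "nat \<Rightarrow> 'k::field point \<Rightarrow> 'k point set \<Rightarrow> 'k point set" where
  "cone_over n p \<Gamma> = (\<Union>x\<in>\<Gamma>. proj_span n {p, x})"


subsection \<open>Homogeneous polynomials and the Zariski topology\<close>

text \<open>
  The outer keys of a polynomial are its monomials; a monomial maps the index of a variable to
  its exponent.
\<close>

type_synonym 'k mpoly = "(nat \<Rightarrow>\<^sub>0 nat) \<Rightarrow>\<^sub>0 'k"

definition poly_value :: "'k::field mpoly \<Rightarrow> 'k vec \<Rightarrow> 'k" where
  "poly_value P v =
     (\<Sum>m\<in>Poly_Mapping.keys P. Poly_Mapping.lookup P m *
        (\<Prod>i\<in>Poly_Mapping.keys m. (v $ i) ^ Poly_Mapping.lookup m i))"

text \<open>Homogeneous polynomials of degree \<open>e\<close> in the variables with indices \<open>0, \<dots>, n\<close>.\<close>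

definition homogeneous :: "nat \<Rightarrow> nat \<Rightarrow> 'k::field mpoly \<Rightarrow> bool" where
  "homogeneous n e P \<longleftrightarrow>
     (\<forall>m\<in>Poly_Mapping.keys P. Poly_Mapping.keys m \<subseteq> {..n} \<and>
        (\<Sum>i\<in>Poly_Mapping.keys m. Poly_Mapping.lookup m i) = e)"

definition distinguished_open :: "nat \<Rightarrow> 'k::field mpoly \<Rightarrow> 'k point set" where
  "distinguished_open n P = {x \<in> proj_space n. \<forall>v\<in>x. poly_value P v \<noteq> 0}"

definition zariski :: "nat \<Rightarrow> 'k::field point topology" where
  "zariski n = topology_generated_by {distinguished_open n P | P e. homogeneous n e P}"

abbreviation zariski_on :: "nat \<Rightarrow> 'k::field point set \<Rightarrow> 'k point topology" where
  "zariski_on n X \<equiv> subtopology (zariski n) X"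


subsection \<open>Regular functions, morphisms and closed immersions\<close>

text \<open>
  A function on an open subset \<open>U\<close> of \<open>X\<close> is regular if it is locally a quotient of
  homogeneous polynomials of the same degree.
\<close>

definition regular_on ::
    "nat \<Rightarrow> 'k::field point set \<Rightarrow> 'k point set \<Rightarrow> ('k point \<Rightarrow> 'k) \<Rightarrow> bool" where
  "regular_on n X U f \<longleftrightarrow>
     (\<forall>x\<in>U. \<exists>W e P Q. openin (zariski_on n X) W \<and> x \<in> W \<and> W \<subseteq> U \<and>
        homogeneous n e P \<and> homogeneous n e Q \<and>
        (\<forall>y\<in>W. \<forall>v\<in>y. poly_value Q v \<noteq> 0 \<and> f y = poly_value P v / poly_value Q v))"

definition variety_morphism ::
    "nat \<Rightarrow> 'k::field point set \<Rightarrow> nat \<Rightarrow> 'k point set \<Rightarrow> ('k point \<Rightarrow> 'k point) \<Rightarrow> bool" where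
  "variety_morphism m X n Y \<phi> \<longleftrightarrow>
     continuous_map (zariski_on m X) (zariski_on n Y) \<phi> \<and>
     (\<forall>V h. openin (zariski_on n Y) V \<and> regular_on n Y V h \<longrightarrow>
        regular_on m X {x \<in> X. \<phi> x \<in> V} (h \<circ> \<phi>))"

text \<open>
  A closed immersion is a morphism that is a homeomorphism onto a closed subset and induces a
  surjection of structure sheaves. The last conjunct is this surjectivity on the stalks at the
  points of the image: every germ of a regular function on \<open>X\<close> is the pullback of a germ of a
  regular function on \<open>Y\<close>. The stalks elsewhere impose no condition as the image is closed.
\<close>

definition closed_immersion ::
    "nat \<Rightarrow> 'k::field point set \<Rightarrow> nat \<Rightarrow> 'k point set \<Rightarrow> ('k point \<Rightarrow> 'k point) \<Rightarrow> bool" where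
  "closed_immersion m X n Y \<phi> \<longleftrightarrow>
     variety_morphism m X n Y \<phi> \<and>
     embedding_map (zariski_on m X) (zariski_on n Y) \<phi> \<and>
     closedin (zariski_on n Y) (\<phi> ` X) \<and>
     (\<forall>U g x. openin (zariski_on m X) U \<and> regular_on m X U g \<and> x \<in> U \<longrightarrow>
        (\<exists>V h U'. openin (zariski_on n Y) V \<and> \<phi> x \<in> V \<and> regular_on n Y V h \<and>
           openin (zariski_on m X) U' \<and> x \<in> U' \<and> U' \<subseteq> U \<and>
           (\<forall>y\<in>U'. \<phi> y \<in> V \<and> h (\<phi> y) = g y)))"


subsection \<open>The weighted projective plane and its linear projections\<close>

text \<open>
  The embedded weighted projective plane with weights \<open>1, 1, n\<close>: the points
  \<open>[u : s^n : s^(n-1) t : \<dots> : t^n]\<close> of projective \<open>(n+1)\<close>-space, for \<open>(s, t, u) \<noteq> 0\<close>.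
  It is only meaningful for \<open>n \<ge> 1\<close>.
\<close>

definition wpp_coords :: "nat \<Rightarrow> 'k::field \<Rightarrow> 'k \<Rightarrow> 'k \<Rightarrow> 'k vec" where
  "wpp_coords n s t u =
     vec (n + 2) (\<lambda>i. if i = 0 then u else s ^ (n - (i - 1)) * t ^ (i - 1))"

definition wpp :: "nat \<Rightarrow> 'k::field point set" where
  "wpp n = {proj_point (wpp_coords n s t u) | s t u. (s, t, u) \<noteq> (0, 0, 0)}"

text \<open>
  A linear projection from projective \<open>N\<close>-space to projective \<open>r\<close>-space is given by a surjective
  linear map; its center is the projectivization of the kernel.
\<close>

definition proj_map :: "'k::field mat \<Rightarrow> 'k point \<Rightarrow> 'k point" where
  "proj_map A x = (\<lambda>v. A *\<^sub>v v) ` x"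

definition linear_projection :: "nat \<Rightarrow> nat \<Rightarrow> 'k::field mat \<Rightarrow> bool" where
  "linear_projection N r A \<longleftrightarrow>
     A \<in> carrier_mat (r + 1) (N + 1) \<and>
     (\<lambda>v. A *\<^sub>v v) ` carrier_vec (N + 1) = carrier_vec (r + 1)"

definition projection_center :: "nat \<Rightarrow> 'k::field mat \<Rightarrow> 'k point set" where
  "projection_center N A = proj_of N (mat_kernel A)"

definition linear_projection_of_wpp :: "nat \<Rightarrow> nat \<Rightarrow> 'k::field point set \<Rightarrow> bool" where
  "linear_projection_of_wpp n r Y \<longleftrightarrow>
     (\<exists>A. linear_projection (n + 1) r A \<and>
          projection_center (n + 1) A \<inter> wpp n = {} \<and>
          Y = proj_map A ` wpp n)"

end

theory Submission
  imports Defs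
begin

text \<open>
  A linear map that sends the vertex of the cone over the rational normal curve of degree \<open>n\<close> to
  \<open>p\<close> and the hyperplane of that curve to \<open>H\<close> projects the cone to the cone with vertex \<open>p\<close> over a
  curve in \<open>H\<close> parametrized by binary forms of degree \<open>n\<close>. The forms can be chosen freely: the
  center avoids the cone when they have no common zero, and the map is surjective when the curve
  spans \<open>H\<close>. The projected cone contains the lines from \<open>p\<close> to all points of the curve. It is
  therefore enough to parametrize a curve in \<open>H\<close> through all points of \<open>\<Gamma>\<close> by forms of degree \<open>n\<close>
  without common zeros, for every \<open>n \<ge> |\<Gamma>|\<close>; the target is then projective \<open>d\<close>-space and
  the immersion is the inclusion.

  The curve (\<open>rational_curve_through_points\<close>) comes from interpolation. Choose a linear functional
  \<open>b\<close> that vanishes at no point of \<open>\<Gamma>\<close> and representatives \<open>v\<^sub>i\<close> with \<open>b \<bullet> v\<^sub>i = 1\<close>. Let \<open>q\<close> be the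
  vector of polynomials of degree less than \<open>|\<Gamma>|\<close> with \<open>q(t\<^sub>i) = v\<^sub>i\<close> at distinct parameters \<open>t\<^sub>i\<close>.
  The polynomial \<open>b \<bullet> q\<close> is \<open>1\<close> at more parameters than its degree, so it is constantly \<open>1\<close> and
  \<open>q\<close> has no zero in the affine line. To make the parametrization nonzero at infinity as well, add
  \<open>K w\<close>, where \<open>K\<close> is monic of degree \<open>n\<close> and vanishes at the \<open>t\<^sub>i\<close>, and \<open>w\<close> is a nonzero vector in
  the kernels of \<open>b\<close> and of the equation of \<open>H\<close>; such a \<open>w\<close> exists because \<open>d + 1 \<ge> 3\<close>.

  The matrix of the projection has the vertex and the coefficient vectors of the curve as columns
  (\<open>cone_matrix_wpp_coords\<close>). It is surjective because its range contains \<open>p\<close> and \<open>\<Gamma>\<close>, which span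
  everything. The inclusion of a closed set is a closed immersion (\<open>closed_immersion_inclusion\<close>),
  and \<open>C\<^sub>\<Gamma>\<close> is closed in projective space as a finite union of lines (\<open>closedin_line\<close>).
\<close>

section \<open>Points and spans\<close>

lemma zero_smult_vec: "(0::'k::field) \<cdot>\<^sub>v v = 0\<^sub>v (dim_vec v)"
  by (intro eq_vecI) auto

lemma mem_proj_point: "w \<in> proj_point v \<longleftrightarrow> (\<exists>c. c \<noteq> 0 \<and> w = c \<cdot>\<^sub>v v)"
  by (auto simp: proj_point_def)

lemma self_mem_proj_point: "v \<in> proj_point v"
  unfolding mem_proj_point by (rule exI[of _ 1]) simp

lemma proj_point_smult:
  assumes "c \<noteq> 0"
  shows "proj_point (c \<cdot>\<^sub>v v) = proj_point v"
proof -
  have "e \<cdot>\<^sub>v v = (e / c) \<cdot>\<^sub>v (c \<cdot>\<^sub>v v)" for e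
    using assms by (simp add: smult_smult_assoc)
  then show ?thesis
    using assms by (auto simp: proj_point_def smult_smult_assoc)
      (metis divide_eq_0_iff nonzero_eq_divide_eq)
qed

lemma proj_point_eqD:
  assumes "proj_point v = proj_point w"
  obtains c where "c \<noteq> 0" "w = c \<cdot>\<^sub>v v"
  using self_mem_proj_point[of w] that unfolding assms[symmetric] by (auto simp: mem_proj_point)

lemma mem_proj_space:
  "x \<in> proj_space n \<longleftrightarrow> (\<exists>v\<in>carrier_vec (n + 1). v \<noteq> 0\<^sub>v (n + 1) \<and> x = proj_point v)"
  by (auto simp: proj_space_def proj_of_def)

text \<open>
  The set \<open>W\<close> is stable under scaling, so all representatives of the point lie in it as soon as one
  does.
\<close>

lemma proj_point_in_proj_of:
  assumes "\<And>c v. v \<in> W \<Longrightarrow> c \<cdot>\<^sub>v v \<in> W" and "v \<noteq> 0\<^sub>v (n + 1)"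
  shows "proj_point v \<in> proj_of n W \<longleftrightarrow> v \<in> W"
proof
  assume "proj_point v \<in> proj_of n W"
  then obtain w where "w \<in> W" "proj_point w = proj_point v" by (auto simp: proj_of_def)
  then show "v \<in> W" using assms(1) by (metis proj_point_eqD)
qed (use assms(2) in \<open>auto simp: proj_of_def\<close>)

abbreviation vec_span :: "nat \<Rightarrow> 'k::field vec set \<Rightarrow> 'k vec set" where
  "vec_span m S \<equiv> LinearCombinations.module.span class_ring (module_vec TYPE('k) m) S"

lemma vec_span_subset:
  fixes S :: "'k::field vec set"
  assumes "S \<subseteq> W" "W \<subseteq> carrier_vec m" "0\<^sub>v m \<in> W"
    and add: "\<And>v w. v \<in> W \<Longrightarrow> w \<in> W \<Longrightarrow> v + w \<in> W"
    and smult: "\<And>c v. v \<in> W \<Longrightarrow> c \<cdot>\<^sub>v v \<in> W"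
  shows "vec_span m S \<subseteq> W"
proof -
  interpret vec_space "TYPE('k)" m .
  have "submodule class_ring W V"
    using assms by (intro submodule.intro) (auto intro: module_axioms)
  then show ?thesis using assms(1) by (rule span_is_subset[rotated])
qed

lemma
  fixes S :: "'k::field vec set"
  assumes "S \<subseteq> carrier_vec m"
  shows vec_span_superset: "S \<subseteq> vec_span m S"
    and vec_span_add: "\<And>v w. v \<in> vec_span m S \<Longrightarrow> w \<in> vec_span m S \<Longrightarrow> v + w \<in> vec_span m S"
    and vec_span_smult: "\<And>c v. v \<in> vec_span m S \<Longrightarrow> c \<cdot>\<^sub>v v \<in> vec_span m S"
proof -
  interpret vec_space "TYPE('k)" m .
  have "submodule class_ring (span S) V"
    using assms by (intro span_is_submodule) auto
  then show "\<And>v w. v \<in> vec_span m S \<Longrightarrow> w \<in> vec_span m S \<Longrightarrow> v + w \<in> vec_span m S"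
    "\<And>c v. v \<in> vec_span m S \<Longrightarrow> c \<cdot>\<^sub>v v \<in> vec_span m S"
    by (auto simp: submodule_def)
  show "S \<subseteq> vec_span m S"
    using assms by (intro in_own_span) auto
qed

lemma proj_point_carrier: "v \<in> carrier_vec m \<Longrightarrow> proj_point v \<subseteq> carrier_vec m"
  by (auto simp: proj_point_def)

lemma vec_span_points:
  fixes p x :: "'k::field vec"
  assumes p: "p \<in> carrier_vec m" and x: "x \<in> carrier_vec m"
  shows "vec_span m (\<Union>{proj_point p, proj_point x}) =
    {\<alpha> \<cdot>\<^sub>v p + \<beta> \<cdot>\<^sub>v x | \<alpha> \<beta>. True}" (is "?S = ?W")
proof
  have sub: "\<Union>{proj_point p, proj_point x} \<subseteq> carrier_vec m"
    using proj_point_carrier[OF p] proj_point_carrier[OF x] by auto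
  show "?S \<subseteq> ?W"
  proof (rule vec_span_subset)
    have "c \<cdot>\<^sub>v p \<in> ?W" for c
      using p x by (intro CollectI exI[of _ c] exI[of _ 0]) auto
    moreover have "c \<cdot>\<^sub>v x \<in> ?W" for c
      using p x by (intro CollectI exI[of _ 0] exI[of _ c]) auto
    ultimately show "\<Union>{proj_point p, proj_point x} \<subseteq> ?W"
      by (auto simp: mem_proj_point)
    show "?W \<subseteq> carrier_vec m" using p x by auto
    show "0\<^sub>v m \<in> ?W"
      using p x by (intro CollectI exI[of _ 0]) auto
  next
    fix v w assume "v \<in> ?W" "w \<in> ?W"
    then obtain \<alpha> \<beta> \<gamma> \<delta> where
      "v = \<alpha> \<cdot>\<^sub>v p + \<beta> \<cdot>\<^sub>v x" "w = \<gamma> \<cdot>\<^sub>v p + \<delta> \<cdot>\<^sub>v x" by auto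
    then have "v + w = (\<alpha> + \<gamma>) \<cdot>\<^sub>v p + (\<beta> + \<delta>) \<cdot>\<^sub>v x"
      using p x by (intro eq_vecI) (auto simp: algebra_simps)
    then show "v + w \<in> ?W" by blast
  next
    fix c v assume "v \<in> ?W"
    then obtain \<alpha> \<beta> where "v = \<alpha> \<cdot>\<^sub>v p + \<beta> \<cdot>\<^sub>v x" by auto
    then have "c \<cdot>\<^sub>v v = (c * \<alpha>) \<cdot>\<^sub>v p + (c * \<beta>) \<cdot>\<^sub>v x"
      using p x by (intro eq_vecI) (auto simp: algebra_simps)
    then show "c \<cdot>\<^sub>v v \<in> ?W" by blast
  qed
  have "p \<in> ?S" "x \<in> ?S"
    using vec_span_superset[OF sub] self_mem_proj_point by blast+
  then show "?W \<subseteq> ?S"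
    using vec_span_add[OF sub] vec_span_smult[OF sub] by blast
qed

section \<open>Homogeneous polynomials and closed sets\<close>

lemma poly_value_smult:
  assumes "homogeneous n e P" "v \<in> carrier_vec (n + 1)"
  shows "poly_value P (c \<cdot>\<^sub>v v) = c ^ e * poly_value P v"
proof -
  have "(\<Prod>i\<in>Poly_Mapping.keys m. ((c \<cdot>\<^sub>v v) $ i) ^ Poly_Mapping.lookup m i) =
      c ^ e * (\<Prod>i\<in>Poly_Mapping.keys m. (v $ i) ^ Poly_Mapping.lookup m i)"
    if "m \<in> Poly_Mapping.keys P" for m
  proof -
    have k: "Poly_Mapping.keys m \<subseteq> {..n}"
      and e: "(\<Sum>i\<in>Poly_Mapping.keys m. Poly_Mapping.lookup m i) = e"
      using assms(1) that by (auto simp: homogeneous_def)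
    have "(\<Prod>i\<in>Poly_Mapping.keys m. ((c \<cdot>\<^sub>v v) $ i) ^ Poly_Mapping.lookup m i) =
        (\<Prod>i\<in>Poly_Mapping.keys m. c ^ Poly_Mapping.lookup m i * (v $ i) ^ Poly_Mapping.lookup m i)"
      using k assms(2) by (intro prod.cong) (auto simp: power_mult_distrib)
    also have "\<dots> = c ^ e * (\<Prod>i\<in>Poly_Mapping.keys m. (v $ i) ^ Poly_Mapping.lookup m i)"
      by (simp add: prod.distrib power_sum flip: e)
    finally show ?thesis .
  qed
  then show ?thesis
    by (simp add: poly_value_def sum_distrib_left mult_ac cong: sum.cong)
qed

definition linear_form :: "nat \<Rightarrow> 'k::field vec \<Rightarrow> 'k mpoly" where
  "linear_form n c = (\<Sum>i\<le>n. Poly_Mapping.single (Poly_Mapping.single i 1) (c $ i))"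

lemma keys_linear_form:
  "Poly_Mapping.keys (linear_form n c) \<subseteq> (\<lambda>i. Poly_Mapping.single i 1) ` {..n}"
  unfolding linear_form_def
  by (rule order.trans[OF keys_sum]) (auto split: if_splits)

lemma homogeneous_linear_form: "homogeneous n 1 (linear_form n c)"
  using keys_linear_form[of n c] by (fastforce simp: homogeneous_def)

lemma poly_value_linear_form:
  assumes "v \<in> carrier_vec (n + 1)"
  shows "poly_value (linear_form n c) v = c \<bullet> v"
proof -
  have inj: "inj_on (\<lambda>i::nat. Poly_Mapping.single i (1::nat)) {..n}"
    by (auto simp: inj_on_def dest: arg_cong[where f = Poly_Mapping.keys])
  have coeff: "Poly_Mapping.lookup (linear_form n c) (Poly_Mapping.single i 1) = c $ i"
    if "i \<le> n" for i
  proof -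
    have "Poly_Mapping.single j (1::nat) = Poly_Mapping.single i 1 \<longleftrightarrow> j = i" for j
      by (auto dest: arg_cong[where f = Poly_Mapping.keys])
    then show ?thesis
      using that by (simp add: linear_form_def lookup_sum lookup_single when_def)
  qed
  have "poly_value (linear_form n c) v =
      (\<Sum>m\<in>(\<lambda>i. Poly_Mapping.single i 1) ` {..n}. Poly_Mapping.lookup (linear_form n c) m *
        (\<Prod>i\<in>Poly_Mapping.keys m. (v $ i) ^ Poly_Mapping.lookup m i))"
    unfolding poly_value_def
    by (rule sum.mono_neutral_left[OF _ keys_linear_form]) (auto simp: in_keys_iff)
  also have "\<dots> = (\<Sum>i\<le>n. c $ i * v $ i)"
    using coeff by (subst sum.reindex[OF inj]) simp
  also have "\<dots> = c \<bullet> v"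
    using assms by (simp add: scalar_prod_def atLeast0LessThan lessThan_Suc_atMost)
  finally show ?thesis .
qed

text \<open>
  The constant \<open>1\<close> is homogeneous of degree \<open>0\<close>, so the whole projective space is one of the
  generating open sets.
\<close>

lemma topspace_zariski: "topspace (zariski n) = (proj_space n :: 'k::field point set)"
proof -
  have "homogeneous n 0 (Poly_Mapping.single 0 (1::'k))"
    by (simp add: homogeneous_def)
  moreover have "distinguished_open n (Poly_Mapping.single 0 (1::'k)) = proj_space n"
    by (simp add: distinguished_open_def poly_value_def)
  ultimately have "(proj_space n :: 'k point set) \<in>
      {distinguished_open n P | P e. homogeneous n e P}" by blast
  moreover have "distinguished_open n P \<subseteq> proj_space n" for P :: "'k mpoly"
    by (auto simp: distinguished_open_def)
  ultimately show ?thesis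
    unfolding zariski_def topology_generated_by_topspace by blast
qed

lemma openin_distinguished_open:
  "homogeneous n e P \<Longrightarrow> openin (zariski n) (distinguished_open n P)"
  unfolding zariski_def by (rule topology_generated_by_Basis) blast

lemma closedin_linear_zeros:
  fixes c :: "'k::field vec"
  assumes c: "c \<in> carrier_vec (n + 1)"
  shows "closedin (zariski n) (proj_of n {v \<in> carrier_vec (n + 1). c \<bullet> v = 0})" (is "closedin _ ?Z")
proof -
  have "proj_point v \<in> ?Z \<longleftrightarrow> c \<bullet> v = 0"
    if "v \<in> carrier_vec (n + 1)" "v \<noteq> 0\<^sub>v (n + 1)" for v
    using that c by (subst proj_point_in_proj_of) auto
  moreover have "proj_point v \<in> distinguished_open n (linear_form n c) \<longleftrightarrow> c \<bullet> v \<noteq> 0"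
    if "v \<in> carrier_vec (n + 1)" "v \<noteq> 0\<^sub>v (n + 1)" for v
  proof -
    have "proj_point v \<in> proj_space n" using that mem_proj_space by blast
    moreover have "poly_value (linear_form n c) (e \<cdot>\<^sub>v v) = e * (c \<bullet> v)" for e
      using that c by (subst poly_value_linear_form) auto
    ultimately show ?thesis
      using self_mem_proj_point[of v] by (fastforce simp: distinguished_open_def mem_proj_point)
  qed
  ultimately have "x \<in> ?Z \<longleftrightarrow> x \<notin> distinguished_open n (linear_form n c)"
    if "x \<in> proj_space n" for x
    using that unfolding mem_proj_space by (elim bexE conjE) simp
  then have "proj_space n - ?Z = distinguished_open n (linear_form n c)"
    by (auto simp: distinguished_open_def)
  moreover have "?Z \<subseteq> proj_space n" by (auto simp: proj_space_def proj_of_def)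
  ultimately show ?thesis
    using openin_distinguished_open[OF homogeneous_linear_form]
    by (simp add: closedin_def topspace_zariski)
qed

text \<open>
  Subtracting the multiple of \<open>p\<close> that kills \<open>a\<close> is the projection from \<open>p\<close> onto the hyperplane
  of \<open>a\<close>. A vector lies on the line exactly when its image is proportional to \<open>x\<close>, and
  since \<open>x\<close> is fixed, the \<open>2 \<times> 2\<close> minors that express this are linear forms.
\<close>

lemma closedin_line:
  fixes p x a :: "'k::field vec"
  assumes p: "p \<in> carrier_vec (n + 1)" and x: "x \<in> carrier_vec (n + 1)"
    and a: "a \<in> carrier_vec (n + 1)"
    and ap: "a \<bullet> p \<noteq> 0" and ax: "a \<bullet> x = 0" and x0: "x \<noteq> 0\<^sub>v (n + 1)"
  shows "closedin (zariski n) (proj_span n {proj_point p, proj_point x})"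
proof -
  (* u i is the functional of the i-th coordinate of the projection from p. *)
  define u where "u i = unit_vec (n + 1) i - (p $ i / (a \<bullet> p)) \<cdot>\<^sub>v a" for i
  define c where "c i j = (x $ j) \<cdot>\<^sub>v u i - (x $ i) \<cdot>\<^sub>v u j" for i j
  define L where "L = {\<alpha> \<cdot>\<^sub>v p + \<beta> \<cdot>\<^sub>v x | \<alpha> \<beta>. True}"
  have u: "u i \<in> carrier_vec (n + 1)" for i using a by (simp add: u_def)
  have c: "c i j \<in> carrier_vec (n + 1)" for i j using u by (simp add: c_def)
  have u_eval: "u i \<bullet> y = y $ i - p $ i * (a \<bullet> y) / (a \<bullet> p)"
    if "y \<in> carrier_vec (n + 1)" "i \<le> n" for i y
    using that a by (simp add: u_def minus_scalar_prod_distrib[of _ "n + 1"])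
  have c_eval: "c i j \<bullet> y = x $ j * (u i \<bullet> y) - x $ i * (u j \<bullet> y)"
    if "y \<in> carrier_vec (n + 1)" for i j y
    using that u by (simp add: c_def minus_scalar_prod_distrib[of _ "n + 1"])
  have L_iff: "y \<in> L \<longleftrightarrow> (\<forall>i\<le>n. \<forall>j\<le>n. c i j \<bullet> y = 0)" if y: "y \<in> carrier_vec (n + 1)" for y
  proof
    assume "y \<in> L"
    then obtain \<alpha> \<beta> where y_eq: "y = \<alpha> \<cdot>\<^sub>v p + \<beta> \<cdot>\<^sub>v x" by (auto simp: L_def)
    have "a \<bullet> y = \<alpha> * (a \<bullet> p)"
      using a p x ax by (simp add: y_eq scalar_prod_add_distrib[of _ "n + 1"])
    then have "u i \<bullet> y = \<beta> * x $ i" if "i \<le> n" for i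
      using that p x ap by (simp add: u_eval[OF y that]) (simp add: y_eq)
    then show "\<forall>i\<le>n. \<forall>j\<le>n. c i j \<bullet> y = 0" by (simp add: c_eval[OF y])
  next
    assume minors: "\<forall>i\<le>n. \<forall>j\<le>n. c i j \<bullet> y = 0"
    obtain j where j: "j \<le> n" "x $ j \<noteq> 0"
    proof -
      have "\<exists>j\<le>n. x $ j \<noteq> 0"
      proof (rule ccontr)
        assume "\<not> ?thesis"
        then have "x = 0\<^sub>v (n + 1)" using x by (intro eq_vecI) auto
        with x0 show False ..
      qed
      then show ?thesis using that by blast
    qed
    have "y = (a \<bullet> y / (a \<bullet> p)) \<cdot>\<^sub>v p + (u j \<bullet> y / x $ j) \<cdot>\<^sub>v x"
    proof (rule eq_vecI)
      fix i assume "i < dim_vec ((a \<bullet> y / (a \<bullet> p)) \<cdot>\<^sub>v p + (u j \<bullet> y / x $ j) \<cdot>\<^sub>v x)"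
      then have i: "i \<le> n" using x by auto
      have "x $ j * (u i \<bullet> y) = x $ i * (u j \<bullet> y)"
        using minors i j by (simp add: c_eval[OF y])
      then have "u i \<bullet> y = u j \<bullet> y / x $ j * x $ i"
        using j by (simp add: field_simps)
      then show "y $ i = ((a \<bullet> y / (a \<bullet> p)) \<cdot>\<^sub>v p + (u j \<bullet> y / x $ j) \<cdot>\<^sub>v x) $ i"
        using i p x by (simp add: u_eval[OF y i] algebra_simps)
    qed (use x y in auto)
    then show "y \<in> L" by (auto simp: L_def)
  qed
  have Lc: "L \<subseteq> carrier_vec (n + 1)" using p x by (auto simp: L_def)
  have line: "proj_span n {proj_point p, proj_point x} = proj_of n L"
    using vec_span_points[OF p x] by (simp add: proj_span_def L_def)
  have "proj_of n L = (\<Inter>i\<in>{..n}. \<Inter>j\<in>{..n}. proj_of n {v \<in> carrier_vec (n + 1). c i j \<bullet> v = 0})"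
    (is "_ = ?R")
  proof (intro equalityI subsetI)
    fix z assume "z \<in> proj_of n L"
    then obtain y where "y \<in> L" "y \<noteq> 0\<^sub>v (n + 1)" "z = proj_point y"
      by (auto simp: proj_of_def)
    moreover from this have "y \<in> carrier_vec (n + 1)" using Lc by blast
    ultimately show "z \<in> ?R" using L_iff[of y] by (auto simp: proj_of_def)
  next
    fix z assume z: "z \<in> ?R"
    then have "z \<in> proj_of n {v \<in> carrier_vec (n + 1). c 0 0 \<bullet> v = 0}" by blast
    then obtain v where v: "v \<in> carrier_vec (n + 1)" "v \<noteq> 0\<^sub>v (n + 1)" "z = proj_point v"
      by (auto simp: proj_of_def)
    have "c i j \<bullet> v = 0" if "i \<le> n" "j \<le> n" for i j
    proof -
      have "proj_point v \<in> proj_of n {v \<in> carrier_vec (n + 1). c i j \<bullet> v = 0}"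
        using z v(3) that by blast
      then show ?thesis
        using v c[of i j] by (subst (asm) proj_point_in_proj_of) auto
    qed
    then have "v \<in> L" using L_iff v by blast
    then show "z \<in> proj_of n L" using v by (auto simp: proj_of_def)
  qed
  moreover have "closedin (zariski n) ?R"
    using closedin_linear_zeros[OF c] by (intro closedin_INT) auto
  ultimately show ?thesis by (simp add: line)
qed

section \<open>Inclusions of closed subsets\<close>

text \<open>
  Only the surjectivity on stalks has content. Near a point, a regular function on \<open>X\<close> is
  a quotient \<open>P / Q\<close> of forms on the ambient space. The same quotient is defined wherever \<open>Q\<close> does
  not vanish, hence on a neighbourhood in \<open>Y\<close>, and does not depend on the representative
  because \<open>P\<close> and \<open>Q\<close> have the same degree.
\<close>

lemma closed_immersion_inclusion:
  fixes X Y :: "'k::field point set"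
  assumes XY: "X \<subseteq> Y" and closed: "closedin (zariski n) X"
  shows "closed_immersion n X n Y id"
proof -
  have XP: "X \<subseteq> proj_space n"
    using closedin_subset[OF closed] by (simp add: topspace_zariski)
  have sub: "zariski_on n X = subtopology (zariski_on n Y) X"
    using XY by (simp add: subtopology_subtopology inf.absorb2)
  have "regular_on n X {x \<in> X. id x \<in> V} (h \<circ> id)"
    if V: "openin (zariski_on n Y) V" and h: "regular_on n Y V h" for V h
    unfolding regular_on_def
  proof
    fix x assume x: "x \<in> {x \<in> X. id x \<in> V}"
    then obtain W e P Q where W: "openin (zariski_on n Y) W" "x \<in> W" "W \<subseteq> V"
      "homogeneous n e P" "homogeneous n e Q"
      "\<forall>y\<in>W. \<forall>v\<in>y. poly_value Q v \<noteq> 0 \<and> h y = poly_value P v / poly_value Q v"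
      using bspec[OF h[unfolded regular_on_def], of x] by auto
    have "openin (zariski_on n X) (W \<inter> X)"
      using W(1) unfolding sub openin_subtopology by blast
    then show "\<exists>W e P Q. openin (zariski_on n X) W \<and> x \<in> W \<and> W \<subseteq> {x \<in> X. id x \<in> V} \<and>
        homogeneous n e P \<and> homogeneous n e Q \<and>
        (\<forall>y\<in>W. \<forall>v\<in>y. poly_value Q v \<noteq> 0 \<and> (h \<circ> id) y = poly_value P v / poly_value Q v)"
      using W x by (intro exI[of _ "W \<inter> X"] exI[of _ e] exI[of _ P] exI[of _ Q]) auto
  qed
  moreover have "continuous_map (zariski_on n X) (zariski_on n Y) id"
    unfolding sub by (simp add: continuous_map_from_subtopology)
  ultimately have "variety_morphism n X n Y id"
    by (simp add: variety_morphism_def)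
  moreover have "embedding_map (zariski_on n X) (zariski_on n Y) id"
    using XY XP by (simp add: embedding_map_def subtopology_subtopology topspace_zariski inf.absorb2)
  moreover have "closedin (zariski_on n Y) X"
    using closed XY unfolding closedin_subtopology by blast
  moreover have "\<exists>V h U'. openin (zariski_on n Y) V \<and> id x \<in> V \<and> regular_on n Y V h \<and>
      openin (zariski_on n X) U' \<and> x \<in> U' \<and> U' \<subseteq> U \<and> (\<forall>y\<in>U'. id y \<in> V \<and> h (id y) = g y)"
    if "openin (zariski_on n X) U" and g: "regular_on n X U g" and x: "x \<in> U" for U g x
  proof -
    obtain W e P Q where W: "openin (zariski_on n X) W" "x \<in> W" "W \<subseteq> U"
      and P: "homogeneous n e P" and Q: "homogeneous n e Q"
      and quot: "\<forall>y\<in>W. \<forall>v\<in>y. poly_value Q v \<noteq> 0 \<and> g y = poly_value P v / poly_value Q v"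
      using bspec[OF g[unfolded regular_on_def] x] by (elim exE conjE)
    obtain T where T: "openin (zariski n) T" "W = T \<inter> X"
      using W(1) by (auto simp: openin_subtopology)
    define V where "V = T \<inter> distinguished_open n Q \<inter> Y"
    define h where "h y = (let v = SOME v. v \<in> y in poly_value P v / poly_value Q v)" for y
    have V: "openin (zariski_on n Y) V"
      unfolding V_def openin_subtopology
      using openin_Int[OF T(1) openin_distinguished_open[OF Q]] by blast
    have h_eq: "h y = poly_value P v / poly_value Q v"
      if y: "y \<in> proj_space n" and v: "v \<in> y" for y v
    proof -
      obtain z where z: "z \<in> carrier_vec (n + 1)" "y = proj_point z"
        using y by (auto simp: mem_proj_space)
      have value_rep: "poly_value P w / poly_value Q w = poly_value P z / poly_value Q z"
        if "w \<in> y" for w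
        using that P Q z by (auto simp: mem_proj_point poly_value_smult)
      have "(SOME v. v \<in> y) \<in> y" using v by (rule someI)
      then show ?thesis using value_rep v by (simp add: h_def)
    qed
    have "regular_on n Y V h"
      unfolding regular_on_def
    proof
      fix y assume "y \<in> V"
      then show "\<exists>W e P Q. openin (zariski_on n Y) W \<and> y \<in> W \<and> W \<subseteq> V \<and>
          homogeneous n e P \<and> homogeneous n e Q \<and>
          (\<forall>y\<in>W. \<forall>v\<in>y. poly_value Q v \<noteq> 0 \<and> h y = poly_value P v / poly_value Q v)"
        using V P Q h_eq
        by (intro exI[of _ V] exI[of _ e] exI[of _ P] exI[of _ Q])
          (auto simp: V_def distinguished_open_def)
    qed
    moreover have "y \<in> V \<and> h y = g y" if y: "y \<in> W" for y
    proof -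
      have yP: "y \<in> proj_space n" and "y \<in> Y" using y T XP XY by auto
      then have "y \<in> V" using y quot T by (auto simp: V_def distinguished_open_def)
      moreover obtain v where "v \<in> y"
        using yP self_mem_proj_point by (auto simp: mem_proj_space)
      ultimately show ?thesis using h_eq[OF yP] quot y by simp
    qed
    ultimately show ?thesis using V W by (intro exI[of _ V] exI[of _ h] exI[of _ W]) auto
  qed
  ultimately show ?thesis by (auto simp: closed_immersion_def)
qed



section \<open>Rational curves through given points\<close>

lemma interpolating_polynomial:
  fixes T :: "'k::field set"
  assumes "finite T" "T \<noteq> {}"
  shows "\<exists>q. degree q < card T \<and> (\<forall>t\<in>T. poly q t = g t)"
  using assms
proof (induction T rule: finite_ne_induct)
  case (singleton t)
  show ?case by (rule exI[of _ "[:g t:]"]) simp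
next
  case (insert t T)
  then obtain q where q: "degree q < card T" "\<forall>s\<in>T. poly q s = g s" by blast
  define M where "M = (\<Prod>s\<in>T. [:- s, 1:])"
  have deg: "degree M = card T"
    by (simp add: M_def degree_prod_eq_sum_degree)
  have M0: "poly M t \<noteq> 0" "poly M s = 0" if "s \<in> T" for s
    using insert that by (auto simp: M_def poly_prod)
  let ?q = "q + Polynomial.smult ((g t - poly q t) / poly M t) M"
  have "degree ?q < card (insert t T)"
    using q(1) insert deg by (auto intro!: degree_add_less le_less_trans[OF degree_smult_le])
  moreover have "\<forall>s\<in>insert t T. poly ?q s = g s"
    using M0 q(2) insert by auto
  ultimately show ?case by blast
qed

text \<open>
  The vector \<open>b\<close> can be found on the moment curve \<open>c \<mapsto> (1, c, c\<^sup>2, \<dots>)\<close>: pairing this curve with a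
  nonzero vector gives a nonzero polynomial in \<open>c\<close>, which excludes only finitely many \<open>c\<close>.
\<close>

lemma generic_functional:
  fixes S :: "'k::field vec set"
  assumes "infinite (UNIV :: 'k set)" "finite S" "S \<subseteq> carrier_vec m" "0\<^sub>v m \<notin> S"
  obtains b where "b \<in> carrier_vec m" "\<And>v. v \<in> S \<Longrightarrow> b \<bullet> v \<noteq> 0"
proof -
  define P where "P v = (\<Sum>i<m. monom (v $ i) i)" for v :: "'k vec"
  have coeff: "coeff (P v) i = v $ i" if "i < m" for v i
    using that by (simp add: P_def coeff_sum)
  have "P v \<noteq> 0" if "v \<in> S" for v
  proof
    assume "P v = 0"
    then have "v = 0\<^sub>v m" using coeff[of _ v] assms that by (intro eq_vecI) auto
    then show False using that assms by simp
  qed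
  then have "finite (\<Union>v\<in>S. {c. poly (P v) c = 0})"
    using assms(2) poly_roots_finite by blast
  then obtain c where c: "c \<notin> (\<Union>v\<in>S. {c. poly (P v) c = 0})"
    using ex_new_if_finite[OF assms(1)] by blast
  have "vec m (\<lambda>i. c ^ i) \<bullet> v = poly (P v) c" if "v \<in> S" for v
    using assms that
    by (auto simp: P_def scalar_prod_def poly_sum poly_monom atLeast0LessThan mult.commute
        intro!: sum.cong)
  then show ?thesis using c that[of "vec m (\<lambda>i. c ^ i)"] by auto
qed

text \<open>
  A square matrix whose first row is \<open>a\<close> and whose other rows, of which there are at least two,
  are all \<open>b\<close> has two equal rows, hence a nonzero kernel.
\<close>

lemma common_orthogonal_vector:
  fixes a b :: "'k::field vec"
  assumes "m \<ge> 3" and a: "a \<in> carrier_vec m" and b: "b \<in> carrier_vec m"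
  obtains w where "w \<in> carrier_vec m" "w \<noteq> 0\<^sub>v m" "a \<bullet> w = 0" "b \<bullet> w = 0"
proof -
  define A where "A = mat m m (\<lambda>(i, j). if i = 0 then a $ j else b $ j)"
  have A: "A \<in> carrier_mat m m" by (simp add: A_def)
  have rows: "row A 0 = a" "row A 1 = b" "row A 2 = b"
    using assms by (auto simp: A_def row_def intro!: eq_vecI)
  then have "det A = 0"
    using det_identical_rows[OF A, of 1 2] assms(1) by simp
  then obtain w where w: "w \<in> carrier_vec m" "w \<noteq> 0\<^sub>v m" "A *\<^sub>v w = 0\<^sub>v m"
    using det_0_iff_vec_prod_zero[OF A] by blast
  have "row A i \<bullet> w = 0" if "i < m" for i
    using arg_cong[OF w(3), of "\<lambda>v. v $ i"] that A by simp
  from this[of 0] this[of 1] show ?thesis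
    using that w rows assms(1) by simp
qed

text \<open>The homogenization of a univariate polynomial to degree \<open>n\<close>.\<close>

definition binary_form :: "nat \<Rightarrow> 'k::field poly \<Rightarrow> 'k \<Rightarrow> 'k \<Rightarrow> 'k" where
  "binary_form n q s t = (\<Sum>i\<le>n. coeff q i * s ^ (n - i) * t ^ i)"

lemma binary_form_sum:
  "binary_form n (\<Sum>r\<in>R. Polynomial.smult (c r) (f r)) s t = (\<Sum>r\<in>R. c r * binary_form n (f r) s t)"
  unfolding binary_form_def
  by (simp add: coeff_sum sum_distrib_left sum_distrib_right mult_ac) (rule sum.swap)

lemma binary_form_0: "binary_form n 0 s t = 0"
  by (simp add: binary_form_def)

lemma binary_form_1: "binary_form n 1 s t = s ^ n"
proof -
  have "binary_form n 1 s t = (\<Sum>i\<in>{0}. coeff 1 i * s ^ (n - i) * t ^ i)"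
    unfolding binary_form_def by (rule sum.mono_neutral_right) auto
  then show ?thesis by simp
qed

lemma binary_form_affine: "degree q \<le> n \<Longrightarrow> binary_form n q 1 t = poly q t"
  unfolding binary_form_def poly_altdef
  by (auto intro!: sum.mono_neutral_right simp: le_degree)

lemma binary_form_infinity: "binary_form n q 0 t = coeff q n * t ^ n"
proof -
  have "binary_form n q 0 t = (\<Sum>i\<in>{n}. coeff q i * 0 ^ (n - i) * t ^ i)"
    unfolding binary_form_def by (rule sum.mono_neutral_right) auto
  then show ?thesis by simp
qed

text \<open>
  The polynomials \<open>f 0, \<dots>, f (m - 1)\<close> are the coordinates of an affine parametrized curve;
  homogenizing them extends the parametrization to the projective line.
\<close>

definition curve_vec :: "nat \<Rightarrow> nat \<Rightarrow> (nat \<Rightarrow> 'k::field poly) \<Rightarrow> 'k \<Rightarrow> 'k \<Rightarrow> 'k vec" where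
  "curve_vec m n f s t = vec m (\<lambda>r. binary_form n (f r) s t)"

lemma curve_vec_carrier [simp]: "curve_vec m n f s t \<in> carrier_vec m"
  by (simp add: curve_vec_def)

lemma scalar_prod_curve_vec:
  "c \<bullet> curve_vec m n f s t = binary_form n (\<Sum>r<m. Polynomial.smult (c $ r) (f r)) s t"
  by (simp add: curve_vec_def scalar_prod_def binary_form_sum atLeast0LessThan)

text \<open>
  The parametrization is \<open>q + K w\<close>, homogenized, with \<open>q\<close> interpolating the normalized vectors
  \<open>v / (b \<bullet> v)\<close> and \<open>K\<close> vanishing at the interpolation nodes. Pairing it with \<open>a\<close> gives \<open>0\<close>
  and pairing it with \<open>b\<close> gives \<open>s\<^sup>n\<close>, so it can vanish only at \<open>s = 0\<close>; there its value is
  \<open>t\<^sup>n w\<close>, which is nonzero for \<open>t \<noteq> 0\<close>.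
\<close>

lemma rational_curve_through_points:
  fixes S :: "'k::field vec set" and a :: "'k vec"
  assumes inf: "infinite (UNIV :: 'k set)" and S: "finite S" "S \<noteq> {}" "S \<subseteq> carrier_vec m" "0\<^sub>v m \<notin> S"
    and m: "m \<ge> 3" and a: "a \<in> carrier_vec m" and aS: "\<And>v. v \<in> S \<Longrightarrow> a \<bullet> v = 0"
    and n: "card S \<le> n"
  obtains f where
    "\<And>s t. a \<bullet> curve_vec m n f s t = 0"
    "\<And>s t. curve_vec m n f s t = 0\<^sub>v m \<Longrightarrow> s = 0 \<and> t = 0"
    "\<And>v. v \<in> S \<Longrightarrow> \<exists>t c. c \<noteq> 0 \<and> curve_vec m n f 1 t = c \<cdot>\<^sub>v v"
proof -
  obtain b where b: "b \<in> carrier_vec m" and bS: "\<And>v. v \<in> S \<Longrightarrow> b \<bullet> v \<noteq> 0"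
    using generic_functional[OF inf S(1,3,4)] by blast
  obtain w where w: "w \<in> carrier_vec m" "w \<noteq> 0\<^sub>v m" "a \<bullet> w = 0" "b \<bullet> w = 0"
    using common_orthogonal_vector[OF m a b] by blast
  obtain T :: "'k set" where T: "finite T" "card T = card S"
    using infinite_arbitrarily_large[OF inf] by blast
  then obtain g where g: "bij_betw g T S"
    using finite_same_card_bij[OF T(1) S(1)] by blast
  have gS: "g t \<in> S" if "t \<in> T" for t using g that by (auto simp: bij_betw_def)
  have T0: "T \<noteq> {}" using T S by auto
  have "\<forall>r. \<exists>q. degree q < card T \<and> (\<forall>t\<in>T. poly q t = g t $ r / (b \<bullet> g t))"
    using interpolating_polynomial[OF T(1) T0, of "\<lambda>t. g t $ r / (b \<bullet> g t)" for r] by simp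
  then obtain q where deg_q: "\<And>r. degree (q r) < card T"
    and q: "\<And>r t. t \<in> T \<Longrightarrow> poly (q r) t = g t $ r / (b \<bullet> g t)"
    by metis
  define K where "K = monom 1 (n - card T) * (\<Prod>t\<in>T. [:- t, 1:])"
  have "lead_coeff K = 1" "degree K = n"
  proof -
    show "lead_coeff K = 1"
      unfolding K_def lead_coeff_mult lead_coeff_prod by (simp add: degree_monom_eq)
    have "(\<Prod>t\<in>T. [:- t, 1:]) \<noteq> 0" using T by simp
    then show "degree K = n"
      using n T by (simp add: K_def degree_mult_eq degree_monom_eq degree_prod_eq_sum_degree)
  qed
  then have K: "degree K = n" "coeff K n = 1" by auto
  have K0: "poly K t = 0" if "t \<in> T" for t
    using that T by (auto simp: K_def poly_prod)
  define f where "f r = q r + Polynomial.smult (w $ r) K" for r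
  have deg_f: "degree (f r) \<le> n" for r
    using deg_q[of r] n T K degree_smult_le[of "w $ r" K]
    by (auto simp: f_def intro!: degree_add_le)
  have coeff_f: "coeff (f r) n = w $ r" for r
    using deg_q[of r] n T K by (simp add: f_def coeff_eq_0)
  (* A functional that kills w ignores the correction term; what remains has degree below the
     number of nodes, so it is determined by its values there. This is used for a with e = 0 and
     for b with e = 1. *)
  have comb: "(\<Sum>r<m. Polynomial.smult (c $ r) (f r)) = [:e:]"
    if c: "c \<in> carrier_vec m" "c \<bullet> w = 0" and e: "\<And>v. v \<in> S \<Longrightarrow> c \<bullet> v = e * (b \<bullet> v)" for c e
  proof -
    have "(\<Sum>r<m. Polynomial.smult (c $ r) (f r)) =
        (\<Sum>r<m. Polynomial.smult (c $ r) (q r)) + Polynomial.smult (c \<bullet> w) K"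
      using w(1) by (simp add: f_def smult_add_right sum.distrib scalar_prod_def
          atLeast0LessThan smult_sum)
    also have "\<dots> = (\<Sum>r<m. Polynomial.smult (c $ r) (q r))" using c by simp
    also have "\<dots> = [:e:]"
    proof (rule poly_eqI_degree[where A = T])
      fix t assume t: "t \<in> T"
      have "g t \<in> carrier_vec m" using gS[OF t] S by blast
      then have "poly (\<Sum>r<m. Polynomial.smult (c $ r) (q r)) t = (c \<bullet> g t) / (b \<bullet> g t)"
        using t q by (simp add: poly_sum scalar_prod_def atLeast0LessThan sum_divide_distrib)
      then show "poly (\<Sum>r<m. Polynomial.smult (c $ r) (q r)) t = poly [:e:] t"
        using e bS gS[OF t] by simp
    next
      show "degree (\<Sum>r<m. Polynomial.smult (c $ r) (q r)) < card T"
        using deg_q T T0 by (intro degree_sum_less le_less_trans[OF degree_smult_le]) auto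
      show "degree [:e:] < card T" using T(1) T0 by (simp add: card_gt_0_iff)
    qed
    finally show ?thesis .
  qed
  show ?thesis
  proof
    show "a \<bullet> curve_vec m n f s t = 0" for s t
      using comb[of a 0] a w aS by (simp add: scalar_prod_curve_vec binary_form_0)
  next
    fix s t assume zero: "curve_vec m n f s t = 0\<^sub>v m"
    have "s ^ n = b \<bullet> curve_vec m n f s t"
      using comb[of b 1] b w by (simp add: scalar_prod_curve_vec binary_form_1 flip: one_pCons)
    then have "s ^ n = 0" using zero b by simp
    then have s: "s = 0" by simp
    have "t ^ n \<cdot>\<^sub>v w = curve_vec m n f s t"
      using w(1) by (auto simp: s curve_vec_def binary_form_infinity coeff_f)
    then have "t ^ n \<cdot>\<^sub>v w = 0\<^sub>v m" using zero by simp
    moreover obtain r where "r < m" "w $ r \<noteq> 0"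
      using w(1,2) by (metis carrier_vecD eq_vecI index_zero_vec)
    ultimately have "t ^ n = 0"
      using w(1) by (auto dest!: arg_cong[where f = "\<lambda>v. v $ r"])
    then show "s = 0 \<and> t = 0" using s by simp
  next
    fix v assume "v \<in> S"
    then obtain t where t: "t \<in> T" "v = g t" using g by (auto simp: bij_betw_def)
    have "v \<in> carrier_vec m" using \<open>v \<in> S\<close> S by blast
    have "binary_form n (f r) 1 t = v $ r / (b \<bullet> v)" for r
      unfolding binary_form_affine[OF deg_f] using t q[OF t(1)] K0[OF t(1)] by (simp add: f_def)
    then have "curve_vec m n f 1 t = (1 / (b \<bullet> v)) \<cdot>\<^sub>v v"
      using \<open>v \<in> carrier_vec m\<close> by (auto simp: curve_vec_def)
    then show "\<exists>t c. c \<noteq> 0 \<and> curve_vec m n f 1 t = c \<cdot>\<^sub>v v"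
      using bS[OF \<open>v \<in> S\<close>] by (intro exI[of _ t] exI[of _ "1 / (b \<bullet> v)"]) simp
  qed
qed


section \<open>Projecting onto the cone over a curve\<close>

text \<open>
  On the embedded weighted projective plane, coordinate \<open>0\<close> is \<open>u\<close> and coordinate \<open>j\<close> with \<open>j \<ge> 1\<close>
  is \<open>s\<^bsup>n-j+1\<^esup> t\<^bsup>j-1\<^esup>\<close>, whence the shift of the columns by one.
\<close>

definition cone_matrix :: "nat \<Rightarrow> nat \<Rightarrow> 'k::field vec \<Rightarrow> (nat \<Rightarrow> 'k poly) \<Rightarrow> 'k mat" where
  "cone_matrix m n p f =
     mat m (n + 2) (\<lambda>(r, j). if j = 0 then p $ r else coeff (f r) (j - 1))"

lemma cone_matrix_carrier: "cone_matrix m n p f \<in> carrier_mat m (n + 2)"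
  by (simp add: cone_matrix_def)

lemma cone_matrix_wpp_coords:
  assumes "p \<in> carrier_vec m"
  shows "cone_matrix m n p f *\<^sub>v wpp_coords n s t u = u \<cdot>\<^sub>v p + curve_vec m n f s t"
proof (rule eq_vecI)
  fix r assume "r < dim_vec (u \<cdot>\<^sub>v p + curve_vec m n f s t)"
  then have r: "r < m" using assms by (simp add: curve_vec_def)
  have "(cone_matrix m n p f *\<^sub>v wpp_coords n s t u) $ r =
      (\<Sum>j<Suc (Suc n). (if j = 0 then p $ r else coeff (f r) (j - 1)) *
        (if j = 0 then u else s ^ (n - (j - 1)) * t ^ (j - 1)))"
    using r by (auto simp: cone_matrix_def wpp_coords_def scalar_prod_def atLeast0LessThan
        intro!: sum.cong)
  also have "\<dots> = p $ r * u + (\<Sum>j<Suc n. coeff (f r) j * (s ^ (n - j) * t ^ j))"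
    by (subst sum.lessThan_Suc_shift) simp
  also have "\<dots> = (u \<cdot>\<^sub>v p + curve_vec m n f s t) $ r"
    using r assms by (simp add: curve_vec_def binary_form_def lessThan_Suc_atMost mult_ac)
  finally show "(cone_matrix m n p f *\<^sub>v wpp_coords n s t u) $ r = (u \<cdot>\<^sub>v p + curve_vec m n f s t) $ r" .
qed (use assms in \<open>simp add: cone_matrix_def curve_vec_def\<close>)

lemma wpp_coords_carrier: "wpp_coords n s t u \<in> carrier_vec (n + 2)"
  by (simp add: wpp_coords_def)

lemma proj_map_proj_point:
  assumes "A \<in> carrier_mat m k" "v \<in> carrier_vec k"
  shows "proj_map A (proj_point v) = proj_point (A *\<^sub>v v)"
  using assms by (auto simp: proj_map_def proj_point_def mult_mat_vec image_def)

lemma vec_span_subset_range: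
  fixes A :: "'k::field mat"
  assumes A: "A \<in> carrier_mat m k" and S: "S \<subseteq> (\<lambda>v. A *\<^sub>v v) ` carrier_vec k"
  shows "vec_span m S \<subseteq> (\<lambda>v. A *\<^sub>v v) ` carrier_vec k" (is "_ \<subseteq> ?R")
proof (rule vec_span_subset[OF S])
  show "?R \<subseteq> carrier_vec m" using A by auto
  show "0\<^sub>v m \<in> ?R" using A by (auto intro!: image_eqI[of _ _ "0\<^sub>v k"])
next
  fix v w assume "v \<in> ?R" "w \<in> ?R"
  then obtain x y where "x \<in> carrier_vec k" "v = A *\<^sub>v x" "y \<in> carrier_vec k" "w = A *\<^sub>v y" by auto
  then show "v + w \<in> ?R"
    using A by (auto intro!: image_eqI[of _ _ "x + y"] simp: mult_add_distrib_mat_vec)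
next
  fix c v assume "v \<in> ?R"
  then obtain x where "x \<in> carrier_vec k" "v = A *\<^sub>v x" by auto
  then show "c \<cdot>\<^sub>v v \<in> ?R"
    using A by (auto intro!: image_eqI[of _ _ "c \<cdot>\<^sub>v x"] simp: mult_mat_vec)
qed

theorem theorem3p9:
  fixes d :: nat
    and H \<Gamma> :: "'k::alg_closed_field point set"
    and p :: "'k point"
  assumes "uncountable (UNIV :: 'k set)"
    and "d \<ge> 2"
    and "hyperplane d H"
    and "finite \<Gamma>" and "\<Gamma> \<subseteq> H" and "proj_span d \<Gamma> = H"
    and "p \<in> proj_space d" and "p \<notin> H"
  shows "\<exists>n0\<ge>1. \<forall>n\<ge>n0. \<exists>r Y \<phi>.
           linear_projection_of_wpp n r Y \<and>
           closed_immersion d (cone_over d p \<Gamma>) r Y \<phi>"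
proof -
  have inf: "infinite (UNIV :: 'k set)"
    using assms(1) by (auto dest: countable_finite)
  obtain a where a: "a \<in> carrier_vec (d + 1)"
    and H: "H = proj_of d {v \<in> carrier_vec (d + 1). a \<bullet> v = 0}"
    using \<open>hyperplane d H\<close> by (auto simp: hyperplane_def)
  have mem_H: "proj_point v \<in> H \<longleftrightarrow> a \<bullet> v = 0"
    if "v \<in> carrier_vec (d + 1)" "v \<noteq> 0\<^sub>v (d + 1)" for v
    unfolding H using that a by (subst proj_point_in_proj_of) auto
  obtain q where q: "q \<in> carrier_vec (d + 1)" "p = proj_point q" and aq: "a \<bullet> q \<noteq> 0"
    using \<open>p \<in> proj_space d\<close> \<open>p \<notin> H\<close> mem_H by (auto simp: mem_proj_space)

  have "\<forall>x\<in>\<Gamma>. \<exists>v. v \<in> carrier_vec (d + 1) \<and> v \<noteq> 0\<^sub>v (d + 1) \<and> a \<bullet> v = 0 \<and> x = proj_point v"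
    using \<open>\<Gamma> \<subseteq> H\<close> by (auto simp: H proj_of_def)
  then obtain rep where rep: "\<And>x. x \<in> \<Gamma> \<Longrightarrow> rep x \<in> carrier_vec (d + 1) \<and>
      rep x \<noteq> 0\<^sub>v (d + 1) \<and> a \<bullet> rep x = 0 \<and> x = proj_point (rep x)"
    by metis
  define S where "S = rep ` \<Gamma>"
  have \<Gamma>: "\<Union>\<Gamma> \<subseteq> carrier_vec (d + 1)"
    using rep proj_point_carrier by blast
  have S: "finite S" "S \<subseteq> carrier_vec (d + 1)" "0\<^sub>v (d + 1) \<notin> S" "card S \<le> card \<Gamma>"
    and aS: "\<And>v. v \<in> S \<Longrightarrow> a \<bullet> v = 0"
    using rep \<open>finite \<Gamma>\<close> card_image_le by (fastforce simp: S_def)+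
  (* The hyperplane has a point because d is positive, so the empty set does not span it. *)
  have "\<Gamma> \<noteq> {}"
  proof
    assume "\<Gamma> = {}"
    then have "H \<subseteq> proj_of d (vec_span (d + 1) {})"
      using \<open>proj_span d \<Gamma> = H\<close> by (simp add: proj_span_def)
    also have "vec_span (d + 1) {} \<subseteq> {0\<^sub>v (d + 1) :: 'k vec}"
      by (rule vec_span_subset) auto
    then have "proj_of d (vec_span (d + 1) {} :: 'k vec set) = {}" by (auto simp: proj_of_def)
    finally have "H = {}" by simp
    moreover obtain w where "w \<in> carrier_vec (d + 1)" "w \<noteq> 0\<^sub>v (d + 1)" "a \<bullet> w = 0"
      using common_orthogonal_vector[OF _ a a] \<open>d \<ge> 2\<close> by auto
    ultimately show False using mem_H by blast
  qed
  then have "S \<noteq> {}" by (simp add: S_def)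

  have closed: "closedin (zariski d) (cone_over d p \<Gamma>)"
    unfolding cone_over_def
  proof (rule closedin_Union)
    show "finite ((\<lambda>x. proj_span d {p, x}) ` \<Gamma>)" using \<open>finite \<Gamma>\<close> by simp
    fix L assume "L \<in> (\<lambda>x. proj_span d {p, x}) ` \<Gamma>"
    then obtain x where "x \<in> \<Gamma>" "L = proj_span d {p, x}" by blast
    then show "closedin (zariski d) L"
      using closedin_line[OF q(1) _ a aq] rep[of x] q(2) by metis
  qed

  have "\<exists>Y. linear_projection_of_wpp n d Y \<and> closed_immersion d (cone_over d p \<Gamma>) d Y id"
    if n: "n \<ge> max 1 (card \<Gamma>)" for n
  proof -
    have "3 \<le> d + 1" "card S \<le> n" using n S(4) \<open>d \<ge> 2\<close> by auto
    then obtain f where af: "\<And>s t. a \<bullet> curve_vec (d + 1) n f s t = 0"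
      and f0: "\<And>s t. curve_vec (d + 1) n f s t = 0\<^sub>v (d + 1) \<Longrightarrow> s = 0 \<and> t = 0"
      and fS: "\<And>v. v \<in> S \<Longrightarrow> \<exists>t c. c \<noteq> 0 \<and> curve_vec (d + 1) n f 1 t = c \<cdot>\<^sub>v v"
      using rational_curve_through_points[OF inf S(1) \<open>S \<noteq> {}\<close> S(2,3) _ a aS] by metis
    define A where "A = cone_matrix (d + 1) n q f"
    have A: "A \<in> carrier_mat (d + 1) (n + 2)"
      unfolding A_def by (rule cone_matrix_carrier)
    have A_wpp: "A *\<^sub>v wpp_coords n s t u = u \<cdot>\<^sub>v q + curve_vec (d + 1) n f s t" for s t u
      unfolding A_def using cone_matrix_wpp_coords[OF q(1)] .
    (* Since n is positive, the forms of degree n vanish at (0, 0), and only u contributes. *)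
    have vertex: "A *\<^sub>v wpp_coords n 0 0 1 = q"
      using n q(1) by (auto simp: A_wpp curve_vec_def binary_form_infinity)

    define R where "R = (\<lambda>v. A *\<^sub>v v) ` carrier_vec (n + 2)"
    have R_wpp: "A *\<^sub>v wpp_coords n s t u \<in> R" for s t u
      unfolding R_def using wpp_coords_carrier by blast
    have R_carrier: "R \<subseteq> carrier_vec (d + 1)" using A by (auto simp: R_def)
    have span_R: "vec_span (d + 1) X \<subseteq> R" if "X \<subseteq> R" for X
      using vec_span_subset_range[OF A] that by (simp add: R_def)
    have R_smult: "c \<cdot>\<^sub>v v \<in> R" if "v \<in> R" for c v
      using that A by (auto simp: R_def mult_mat_vec[symmetric])
    have R_add: "v + w \<in> R" if "v \<in> R" "w \<in> R" for v w
      using that A by (auto simp: R_def mult_add_distrib_mat_vec[symmetric])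
    have "S \<subseteq> R"
    proof
      fix v assume v: "v \<in> S"
      then have vc: "v \<in> carrier_vec (d + 1)" using S(2) by blast
      from v obtain t c where c: "c \<noteq> 0" "curve_vec (d + 1) n f 1 t = c \<cdot>\<^sub>v v"
        using fS by blast
      have "A *\<^sub>v wpp_coords n 1 t 0 = c \<cdot>\<^sub>v v"
        unfolding A_wpp c(2) using q(1) vc by (intro eq_vecI) auto
      then have "v = (1 / c) \<cdot>\<^sub>v (A *\<^sub>v wpp_coords n 1 t 0)"
        using c(1) by (simp add: smult_smult_assoc)
      then show "v \<in> R" using R_smult[OF R_wpp] by metis
    qed
    have "\<Union>\<Gamma> \<subseteq> R"
    proof
      fix v assume "v \<in> \<Union>\<Gamma>"
      then obtain x where x: "x \<in> \<Gamma>" "v \<in> x" by blast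
      then have "v \<in> proj_point (rep x)" using rep by blast
      then obtain c where "v = c \<cdot>\<^sub>v rep x" by (auto simp: mem_proj_point)
      moreover have "rep x \<in> R" using \<open>S \<subseteq> R\<close> x(1) by (auto simp: S_def)
      ultimately show "v \<in> R" using R_smult by blast
    qed
    have "carrier_vec (d + 1) \<subseteq> R"
    proof
      fix y :: "'k vec" assume y: "y \<in> carrier_vec (d + 1)"
      define z where "z = y - (a \<bullet> y / (a \<bullet> q)) \<cdot>\<^sub>v q"
      have z: "z \<in> carrier_vec (d + 1)" using y q by (simp add: z_def)
      have az: "a \<bullet> z = 0"
        using a y q aq by (simp add: z_def scalar_prod_minus_distrib[of _ "d + 1"])
      have "z \<in> vec_span (d + 1) (\<Union>\<Gamma>)" if "z \<noteq> 0\<^sub>v (d + 1)"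
      proof -
        have "proj_point z \<in> proj_of d (vec_span (d + 1) (\<Union>\<Gamma>))"
          using mem_H[OF z that] az \<open>proj_span d \<Gamma> = H\<close> by (simp add: proj_span_def)
        then show ?thesis
          using that vec_span_smult[OF \<Gamma>] by (subst (asm) proj_point_in_proj_of) auto
      qed
      moreover have "0\<^sub>v (d + 1) \<in> R"
        unfolding R_def using A by (auto intro!: image_eqI[of _ _ "0\<^sub>v (n + 2)"])
      ultimately have "z \<in> R" using span_R[OF \<open>\<Union>\<Gamma> \<subseteq> R\<close>] by blast
      moreover have "(a \<bullet> y / (a \<bullet> q)) \<cdot>\<^sub>v q \<in> R"
        using R_smult R_wpp vertex by metis
      moreover have "y = z + (a \<bullet> y / (a \<bullet> q)) \<cdot>\<^sub>v q"
        using y q by (auto simp: z_def)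
      ultimately show "y \<in> R" using R_add by metis
    qed
    then have proj: "linear_projection (n + 1) d A"
      using A R_carrier by (auto simp: linear_projection_def R_def)

    have "x \<notin> wpp n" if "x \<in> projection_center (n + 1) A" for x
    proof
      assume "x \<in> wpp n"
      then obtain s t u where stu: "(s, t, u) \<noteq> (0, 0, 0)" "x = proj_point (wpp_coords n s t u)"
        by (auto simp: wpp_def)
      obtain v where v: "v \<in> carrier_vec (n + 2)" "A *\<^sub>v v = 0\<^sub>v (d + 1)" "x = proj_point v"
        using \<open>x \<in> projection_center (n + 1) A\<close> A
        by (auto simp: projection_center_def proj_of_def mat_kernel_def)
      then obtain c where c: "wpp_coords n s t u = c \<cdot>\<^sub>v v"
        using stu(2) by (metis proj_point_eqD)
      have "A *\<^sub>v wpp_coords n s t u = 0\<^sub>v (d + 1)"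
        unfolding c mult_mat_vec[OF A v(1)] v(2) by (intro eq_vecI) simp_all
      then have zero: "u \<cdot>\<^sub>v q + curve_vec (d + 1) n f s t = 0\<^sub>v (d + 1)"
        unfolding A_wpp .
      have "u * (a \<bullet> q) = a \<bullet> (u \<cdot>\<^sub>v q + curve_vec (d + 1) n f s t)"
        using a q(1) af by (subst scalar_prod_add_distrib[of _ "d + 1"]) auto
      then have "u = 0" using zero a aq by simp
      with zero q(1) have "curve_vec (d + 1) n f s t = 0\<^sub>v (d + 1)"
        by (simp add: zero_smult_vec left_zero_vec[OF curve_vec_carrier])
      with f0 \<open>u = 0\<close> stu(1) show False by blast
    qed
    then have wpp_proj: "linear_projection_of_wpp n d (proj_map A ` wpp n)"
      using proj by (auto simp: linear_projection_of_wpp_def)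

    have image: "proj_point (A *\<^sub>v wpp_coords n s t u) \<in> proj_map A ` wpp n"
      if "(s, t, u) \<noteq> (0, 0, 0)" for s t u
      using that proj_map_proj_point[OF A wpp_coords_carrier]
      by (auto simp: wpp_def intro!: image_eqI[of _ _ "proj_point (wpp_coords n s t u)"])
    have "cone_over d p \<Gamma> \<subseteq> proj_map A ` wpp n"
    proof
      fix z assume "z \<in> cone_over d p \<Gamma>"
      then obtain x where x: "x \<in> \<Gamma>" "z \<in> proj_span d {p, x}" by (auto simp: cone_over_def)
      define v where "v = rep x"
      have v: "v \<in> S" "v \<in> carrier_vec (d + 1)" "x = proj_point v"
        using rep[OF x(1)] x(1) by (auto simp: v_def S_def)
      have "z \<in> proj_of d {\<alpha> \<cdot>\<^sub>v q + \<beta> \<cdot>\<^sub>v v | \<alpha> \<beta>. True}"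
        using x(2) vec_span_points[OF q(1) v(2)] by (simp add: proj_span_def q(2) v(3))
      then obtain \<alpha> \<beta> where z: "z = proj_point (\<alpha> \<cdot>\<^sub>v q + \<beta> \<cdot>\<^sub>v v)"
        and nz: "\<alpha> \<cdot>\<^sub>v q + \<beta> \<cdot>\<^sub>v v \<noteq> 0\<^sub>v (d + 1)"
        by (auto simp: proj_of_def)
      show "z \<in> proj_map A ` wpp n"
      proof (cases "\<beta> = 0")
        case True
        then have "\<alpha> \<cdot>\<^sub>v q + \<beta> \<cdot>\<^sub>v v = \<alpha> \<cdot>\<^sub>v q" using q(1) v(2) by (simp add: zero_smult_vec)
        moreover from this nz have "\<alpha> \<noteq> 0" using q(1) by (auto simp: zero_smult_vec)
        ultimately have "z = proj_point q" using z by (simp add: proj_point_smult)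
        then show ?thesis using image[of 0 0 1] vertex by simp
      next
        case False
        obtain t c where c: "c \<noteq> 0" "curve_vec (d + 1) n f 1 t = c \<cdot>\<^sub>v v"
          using fS[OF v(1)] by blast
        (* The curve passes through c v instead of v, so the point is first rescaled by c / \<beta>. *)
        have "A *\<^sub>v wpp_coords n 1 t (c * \<alpha> / \<beta>) = (c / \<beta>) \<cdot>\<^sub>v (\<alpha> \<cdot>\<^sub>v q + \<beta> \<cdot>\<^sub>v v)"
          unfolding A_wpp c(2) using False q(1) v(2)
          by (intro eq_vecI) (auto simp: field_simps)
        then have "z = proj_point (A *\<^sub>v wpp_coords n 1 t (c * \<alpha> / \<beta>))"
          using c(1) False z by (simp add: proj_point_smult)
        then show ?thesis using image[of 1 t] by simp
      qed
    qed
    then show ?thesis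
      using closed_immersion_inclusion closed wpp_proj by blast
  qed
  then show ?thesis
    by (intro exI[of _ "max 1 (card \<Gamma>)"]) (meson max.cobounded1)
qed

end
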